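(* Let $X$ and $Y$ be metric spaces and let $f\colon X\to Y$ be a continuous surjection. Suppose that $X$ is complete and that $f$ is uniformly open. Then there exists a closed subspace $Z\subseteq X$ with $\operatorname{dens} Z=\operatorname{dens} Y$ such that the restriction $f|_Z\colon Z\to Y$ is uniformly open and surjective. Moreover, if $X$ is a Banach space (with the metric induced by its norm), then $Z$ may be taken to be a closed linear subspace of $X$.
   Context: A map $f\colon X\to Y$ between metric spaces is uniformly open if for each $\varepsilon>0$ there is $\delta>0$ such that for every $x\in X$ one has $B(f(x),\delta)\subseteq f(B(x,\varepsilon))$, where $B(\cdot,r)$ denotes the ball of radius $r$ in the respective space. For the restriction $f|_Z\colon Z\to Y$, balls in the domain are taken in the metric subspace $Z$ and balls in the codomain are taken in $Y$. For a topological space $W$, the density $\operatorname{dens} W$ is the smallest cardinality of a dense subset of $W$. Banach spaces may be over the real or the complex scalars. *)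

theory Defs
  imports "HOL-Analysis.Analysis"
begin

definition dense_in :: "'a topology \<Rightarrow> 'a set \<Rightarrow> bool" where
  "dense_in W D \<longleftrightarrow> D \<subseteq> topspace W \<and> W closure_of D = topspace W"

text \<open>Cardinal numbers are represented by cardinal well-orders, so \<^term>\<open>dens W\<close> is determined
  up to order isomorphism only, and densities are compared by \<^const>\<open>ordIso\<close> and
  \<^const>\<open>ordLeq\<close>, also across different types.\<close>

definition dens :: "'a topology \<Rightarrow> 'a rel" where
  "dens W = (SOME r. (\<exists>D. dense_in W D \<and> r = card_of D) \<and>
                     (\<forall>D. dense_in W D \<longrightarrow> (r, card_of D) \<in> ordLeq))"

lemma dens_attained:
  "(\<exists>D. dense_in W D \<and> dens W = card_of D) \<and>
   (\<forall>D. dense_in W D \<longrightarrow> (dens W, card_of D) \<in> ordLeq)"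
proof -
  let ?R = "card_of ` {D. dense_in W D}"
  have "dense_in W (topspace W)"
    by (simp add: dense_in_def)
  hence "?R \<noteq> {}"
    by blast
  moreover have "\<forall>r\<in>?R. Well_order r"
    by (auto simp: card_of_Well_order)
  ultimately obtain r where "r \<in> ?R" "\<forall>r'\<in>?R. (r, r') \<in> ordLeq"
    using exists_minim_Well_order[of ?R] by blast
  hence "\<exists>r. (\<exists>D. dense_in W D \<and> r = card_of D) \<and>
             (\<forall>D. dense_in W D \<longrightarrow> (r, card_of D) \<in> ordLeq)"
    by blast
  thus ?thesis
    unfolding dens_def by (rule someI_ex)
qed

text \<open>Metric spaces are given as subsets \<open>X\<close>, \<open>Y\<close> of metric-space types with the induced metric,
  so that the empty space is included and the restriction of \<open>f\<close> to \<open>Z \<subseteq> X\<close> is obtained by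
  replacing \<open>X\<close> by \<open>Z\<close>.\<close>

definition uniformly_open_on ::
    "'a::metric_space set \<Rightarrow> 'b::metric_space set \<Rightarrow> ('a \<Rightarrow> 'b) \<Rightarrow> bool" where
  "uniformly_open_on X Y f \<longleftrightarrow>
     (\<forall>\<epsilon>>0. \<exists>\<delta>>0. \<forall>x\<in>X. ball (f x) \<delta> \<inter> Y \<subseteq> f ` (ball x \<epsilon> \<inter> X))"

text \<open>Real Banach spaces are the types of class \<^class>\<open>banach\<close>. A complex Banach space is a real one
  together with a complex scalar multiplication that extends the real one and for which the norm
  is homogeneous.\<close>

locale complex_banach = vector_space scaleC
  for scaleC :: "complex \<Rightarrow> 'a::banach \<Rightarrow> 'a" +
  assumes scaleC_of_real: "scaleC (of_real r) x = r *\<^sub>R x"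
    and norm_scaleC: "norm (scaleC c x) = cmod c * norm x"

end

theory Submission
  imports Defs
begin

text \<open>Let \<open>D\<close> be a dense subset of \<open>Y\<close> of cardinality \<open>dens Y\<close>, assumed infinite. Close a set of
  preimages of the points of \<open>D\<close> under one choice function that lifts small steps from $f(a)$ to
  points of \<open>D\<close> to small steps from \<open>a\<close>, and in the linear case also under addition and
  multiplication by a countable dense set of scalars. This gives a set \<open>A\<close> of cardinality at most
  \<open>dens Y\<close>. Its closure \<open>Z\<close> works: every $y \in Y$ near $f(a)$ is the limit of points of \<open>D\<close> whose
  successive lifts in \<open>A\<close> form a Cauchy sequence, as in the proof of the open mapping theorem.
  If \<open>dens Y\<close> is finite, then \<open>Y\<close> is finite, and in the linear case a point by connectedness.\<close>

section \<open>Density of subspaces and of continuous images\<close>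

lemma dense_in_top_of_set_iff: "dense_in (top_of_set S) D \<longleftrightarrow> D \<subseteq> S \<and> S \<subseteq> closure D"
proof -
  have "S \<inter> D = D" if "D \<subseteq> S"
    using that by blast
  thus ?thesis
    by (auto simp: dense_in_def closure_of_subtopology)
qed

lemma dens_top_of_set_le:
  assumes "A \<subseteq> S" "S \<subseteq> closure A"
  shows "(dens (top_of_set S), card_of A) \<in> ordLeq"
  using assms dens_attained[of "top_of_set S"] by (simp add: dense_in_top_of_set_iff)

text \<open>A continuous map sends a dense subset of \<open>S\<close> of least cardinality to a
  dense subset of the image, and taking images does not increase cardinality.\<close>

lemma dens_continuous_image_le:
  fixes f :: "'a::metric_space \<Rightarrow> 'b::metric_space"
  assumes cont: "continuous_on S f"
  shows "(dens (top_of_set (f ` S)), dens (top_of_set S)) \<in> ordLeq"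
proof -
  obtain A where A: "A \<subseteq> S" "S \<subseteq> closure A" "dens (top_of_set S) = card_of A"
    using dens_attained[of "top_of_set S"] by (auto simp: dense_in_top_of_set_iff)
  have "f x \<in> closure (f ` A)" if x: "x \<in> S" for x
    unfolding closure_approachable
  proof (intro allI impI)
    fix e :: real assume "e > 0"
    then obtain d where d: "d > 0" "\<And>x'. x' \<in> S \<Longrightarrow> dist x' x < d \<Longrightarrow> dist (f x') (f x) < e"
      using cont[unfolded continuous_on_iff, rule_format, OF x \<open>e > 0\<close>] by blast
    moreover obtain a where "a \<in> A" "dist a x < d"
      using A(2) x d(1) unfolding closure_approachable subset_iff by blast
    ultimately show "\<exists>y\<in>f ` A. dist y (f x) < e"
      using A(1) by blast
  qed
  hence "(dens (top_of_set (f ` S)), card_of (f ` A)) \<in> ordLeq"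
    using A(1) by (intro dens_top_of_set_le) auto
  thus ?thesis
    unfolding A(3) using card_of_image ordLeq_transitive by blast
qed

text \<open>The dense set \<open>A\<close> bounds the density of \<open>Z\<close> from above by that
  of \<open>Y\<close>; the continuous surjection onto \<open>Y\<close> bounds it from below.\<close>

lemma dens_eq_of_dense_and_surj:
  fixes f :: "'a::metric_space \<Rightarrow> 'b::metric_space"
  assumes "A \<subseteq> Z" "Z \<subseteq> closure A" "(card_of A, dens (top_of_set Y)) \<in> ordLeq"
    and "continuous_on Z f" "f ` Z = Y"
  shows "(dens (top_of_set Z), dens (top_of_set Y)) \<in> ordIso"
  using dens_top_of_set_le[OF assms(1,2)] dens_continuous_image_le[OF assms(4)] assms(3,5)
  by (meson ordIso_iff_ordLeq ordLeq_transitive)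

section \<open>Cardinality of the closure of a set under operations\<close>

lemma countable_ordLeq_infinite:
  assumes "countable A" "infinite B"
  shows "(card_of A, card_of B) \<in> ordLeq"
proof -
  have "(card_of A, card_of (UNIV :: nat set)) \<in> ordLeq"
    using assms(1) unfolding countable_def card_of_ordLeq[symmetric] by auto
  thus ?thesis
    using assms(2) infinite_iff_card_of_nat ordLeq_transitive by blast
qed

text \<open>Adjoining all values of the operations is iterated countably often. Every stage stays
  within the cardinality of \<open>D\<close>, because an infinite cardinal absorbs finite products
  and countable unions. Unary operations are covered as binary ones that ignore an argument.\<close>

lemma closure_under_operations:
  fixes F :: "('a \<Rightarrow> 'a \<Rightarrow> 'a) set"
  assumes inf: "infinite D"
    and B: "B \<subseteq> X" "(card_of B, card_of D) \<in> ordLeq"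
    and F: "(card_of F, card_of D) \<in> ordLeq"
    and X: "\<And>g x y. g \<in> F \<Longrightarrow> x \<in> X \<Longrightarrow> y \<in> X \<Longrightarrow> g x y \<in> X"
  obtains A where "B \<subseteq> A" "A \<subseteq> X" "(card_of A, card_of D) \<in> ordLeq"
    "\<And>g x y. g \<in> F \<Longrightarrow> x \<in> A \<Longrightarrow> y \<in> A \<Longrightarrow> g x y \<in> A"
proof -
  define S where "S = (\<lambda>C. C \<union> (\<lambda>(g, x, y). g x y) ` (F \<times> C \<times> C))"
  define C where "C = (\<lambda>n. (S ^^ n) B)"
  have C_Suc: "C (Suc n) = S (C n)" and C0: "C 0 = B" for n
    by (simp_all add: C_def)
  have CX: "C n \<subseteq> X" for n
  proof (induction n)
    case (Suc n)
    have "g x y \<in> X" if "g \<in> F" "x \<in> C n" "y \<in> C n" for g x y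
      using X[of g x y] that Suc by blast
    thus ?case
      using Suc by (auto simp: C_Suc S_def)
  qed (use B in \<open>simp add: C0\<close>)
  have Times: "(card_of (P \<times> Q), card_of D) \<in> ordLeq"
    if "(card_of P, card_of D) \<in> ordLeq" "(card_of Q, card_of D) \<in> ordLeq"
    for P :: "'x set" and Q :: "'y set"
    using that inf by (intro card_of_Times_ordLeq_infinite_Field) (auto simp: Field_card_of card_of_card_order_on)
  have C_le: "(card_of (C n), card_of D) \<in> ordLeq" for n
  proof (induction n)
    case (Suc n)
    have "(card_of ((\<lambda>(g, x, y). g x y) ` (F \<times> C n \<times> C n)), card_of D) \<in> ordLeq"
      using Times[OF F Times[OF Suc Suc]] card_of_image ordLeq_transitive by blast
    thus ?case
      unfolding C_Suc S_def using Suc inf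
      by (intro card_of_Un_ordLeq_infinite_Field) (auto simp: Field_card_of card_of_card_order_on)
  qed (use B in \<open>simp add: C0\<close>)
  have "C m \<subseteq> C n" if "m \<le> n" for m n
    using that by (rule lift_Suc_mono_le[rotated]) (auto simp: C_Suc S_def)
  \<comment> \<open>The stages increase, so two elements of the union already lie in a common stage,
    and the next stage contains the value of the operation at them.\<close>
  hence mono: "C m \<subseteq> C (max m n)" "C n \<subseteq> C (max m n)" for m n
    by simp_all
  show ?thesis
  proof
    show "B \<subseteq> (\<Union>n. C n)"
      using C0 by blast
    show "(\<Union>n. C n) \<subseteq> X"
      using CX by blast
    show "(card_of (\<Union>n. C n), card_of D) \<in> ordLeq"
      using inf C_le by (intro card_of_UNION_ordLeq_infinite countable_ordLeq_infinite) auto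
    show "g x y \<in> (\<Union>n. C n)" if g: "g \<in> F" and xy: "x \<in> (\<Union>n. C n)" "y \<in> (\<Union>n. C n)" for g x y
    proof -
      obtain n where "x \<in> C n" "y \<in> C n"
        using xy mono by blast
      hence "g x y \<in> C (Suc n)"
        using g unfolding C_Suc S_def by force
      thus ?thesis by blast
    qed
  qed
qed

section \<open>Successive approximation with geometric steps\<close>

text \<open>The bound is the exact partial sum of the geometric series; the factor with
  \<open>k\<close> makes the induction close and is dropped later.\<close>

lemma geometric_steps_dist:
  fixes s :: "nat \<Rightarrow> 'a::metric_space"
  assumes "\<And>n. dist (s n) (s (Suc n)) < (1/2) ^ (m + n)"
  shows "dist (s n) (s (n + k)) \<le> 2 * (1/2) ^ (m + n) * (1 - (1/2) ^ k)"
proof (induction k)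
  case (Suc k)
  have "dist (s n) (s (n + Suc k)) \<le> dist (s n) (s (n + k)) + dist (s (n + k)) (s (Suc (n + k)))"
    by (simp add: dist_triangle)
  also have "\<dots> \<le> 2 * (1/2) ^ (m + n) * (1 - (1/2) ^ k) + (1/2) ^ (m + (n + k))"
    using Suc assms[of "n + k"] by linarith
  also have "\<dots> = 2 * (1/2) ^ (m + n) * (1 - (1/2) ^ Suc k)"
    by (simp add: power_add algebra_simps)
  finally show ?case .
qed simp

text \<open>The points $s_n \in A$ are chosen so that $f(s_n)$ approaches \<open>y\<close> and $d(s_n, s_{n+1})$ decays
  geometrically; their limit is the desired point.\<close>

lemma approximate_lifts_limit:
  fixes f :: "'a::metric_space \<Rightarrow> 'b::metric_space"
  assumes X: "complete X" "continuous_on X f" "A \<subseteq> X"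
    and \<delta>: "\<And>n. \<delta> n > 0" "\<delta> \<longlonglongrightarrow> 0"
    and lift: "\<And>a n d. a \<in> A \<Longrightarrow> d \<in> D \<Longrightarrow> dist (f a) d < \<delta> n \<Longrightarrow>
                 \<exists>a'\<in>A. dist a a' < (1/2) ^ n \<and> f a' = d"
    and a: "a \<in> A" and y: "y \<in> closure D" "dist (f a) y < \<delta> m"
  shows "\<exists>x\<in>closure A. dist a x \<le> 2 * (1/2) ^ m \<and> f x = y"
proof -
  \<comment> \<open>The conjunct for \<open>n = 0\<close> pins the start of the sequence to
    \<open>a\<close>, so that the bound on the total displacement is measured from
    \<open>a\<close>.\<close>
  have "\<exists>s. \<forall>n. (s n \<in> A \<and> dist (f (s n)) y < \<delta> (m + n) \<and> (n = 0 \<longrightarrow> s n = a)) \<and>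
             dist (s n) (s (Suc n)) < (1/2) ^ (m + n)"
  proof (rule dependent_nat_choice)
    show "\<exists>x. x \<in> A \<and> dist (f x) y < \<delta> (m + 0) \<and> (0 = 0 \<longrightarrow> x = a)"
      using a y by auto
    fix x n assume x: "x \<in> A \<and> dist (f x) y < \<delta> (m + n) \<and> (n = 0 \<longrightarrow> x = a)"
    \<comment> \<open>Taking \<open>d\<close> this close to \<open>y\<close> serves two purposes:
      the second term of the minimum makes \<open>d\<close> liftable from \<open>x\<close> at level
      \<open>m + n\<close>, and the first one restores the invariant at the next level, as
      \<open>f x' = d\<close>.\<close>
    define e where "e = min (\<delta> (m + Suc n)) (\<delta> (m + n) - dist (f x) y)"
    have "e > 0"
      using x \<delta>(1) by (simp add: e_def)
    then obtain d where d: "d \<in> D" "dist d y < e"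
      using y(1) unfolding closure_approachable by blast
    have "dist (f x) d < \<delta> (m + n)"
      using d(2) dist_triangle[of "f x" d y] by (simp add: e_def dist_commute)
    then obtain x' where "x' \<in> A" "dist x x' < (1/2) ^ (m + n)" "f x' = d"
      using lift x d(1) by blast
    thus "\<exists>x'. (x' \<in> A \<and> dist (f x') y < \<delta> (m + Suc n) \<and> (Suc n = 0 \<longrightarrow> x' = a)) \<and>
                dist x x' < (1/2) ^ (m + n)"
      using d(2) by (auto simp: e_def)
  qed
  then obtain s where s: "\<And>n. s n \<in> A" "\<And>n. dist (f (s n)) y < \<delta> (m + n)" "s 0 = a"
      "\<And>n. dist (s n) (s (Suc n)) < (1/2) ^ (m + n)"
    by blast
  have s_dist: "dist (s n) (s (n + k)) \<le> 2 * (1/2) ^ (m + n)" for n k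
  proof -
    have "2 * (1/2) ^ (m + n) * (1 - (1/2) ^ k) \<le> 2 * (1/2 :: real) ^ (m + n) * 1"
      by (intro mult_left_mono) auto
    thus ?thesis
      using geometric_steps_dist[of s m, OF s(4), of n k] by linarith
  qed
  have "Cauchy s"
  proof (rule metric_CauchyI)
    fix e :: real assume "e > 0"
    then obtain N where N: "(1/2 :: real) ^ N < e / 4"
      using real_arch_pow_inv[of "e / 4" "1/2"] by auto
    have less: "dist (s N) (s n) < e / 2" if n: "n \<ge> N" for n
    proof -
      have "dist (s N) (s n) \<le> 2 * (1/2) ^ (m + N)"
        using s_dist[of N "n - N"] n by simp
      also have "\<dots> \<le> 2 * (1/2) ^ N"
        by (intro mult_left_mono power_decreasing) auto
      finally show ?thesis using N by simp
    qed
    have "dist (s i) (s j) < e" if "i \<ge> N" "j \<ge> N" for i j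
      using less[OF that(1)] less[OF that(2)] dist_triangle3[of "s i" "s j" "s N"] by linarith
    thus "\<exists>M. \<forall>i\<ge>M. \<forall>j\<ge>M. dist (s i) (s j) < e"
      by blast
  qed
  moreover have "s n \<in> X" for n
    using s(1) X(3) by blast
  ultimately obtain x where x: "x \<in> X" "s \<longlonglongrightarrow> x"
    using X(1) unfolding complete_def by blast
  have "x \<in> closure A"
    using x(2) s(1) closure_sequential by blast
  moreover have "dist a x \<le> 2 * (1/2) ^ m"
    using s_dist[of 0] s(3) by (intro Lim_dist_ubound[OF _ x(2)]) auto
  moreover have "f x = y"
  proof (rule LIMSEQ_unique)
    show "(\<lambda>n. f (s n)) \<longlonglongrightarrow> f x"
      using x(1) \<open>\<And>n. s n \<in> X\<close> by (intro continuous_on_tendsto_compose[OF X(2) x(2)] always_eventually) auto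
    have "(\<lambda>n. dist (f (s n)) y) \<longlonglongrightarrow> 0"
    proof (rule Lim_null_comparison)
      show "(\<lambda>n. \<delta> (m + n)) \<longlonglongrightarrow> 0"
        using LIMSEQ_ignore_initial_segment[OF \<delta>(2), of m] by (simp add: add.commute)
    qed (use s(2) in \<open>simp add: less_imp_le\<close>)
    thus "(\<lambda>n. f (s n)) \<longlonglongrightarrow> y"
      using tendsto_dist_iff by blast
  qed
  ultimately show ?thesis by blast
qed

section \<open>Restriction when the dense set is infinite\<close>

text \<open>The parameter \<open>G\<close> lets one construction serve both cases: it is empty for
  metric spaces and consists of addition and countably many scalar multiplications for Banach
  spaces.\<close>

lemma uniformly_open_restriction:
  fixes f :: "'a::metric_space \<Rightarrow> 'b::metric_space" and G :: "('a \<Rightarrow> 'a \<Rightarrow> 'a) set"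
  assumes X: "complete X" "continuous_on X f" "f ` X = Y" "uniformly_open_on X Y f"
    and D: "infinite D" "D \<subseteq> Y" "Y \<subseteq> closure D"
    and G: "countable G" "\<And>g x y. g \<in> G \<Longrightarrow> x \<in> X \<Longrightarrow> y \<in> X \<Longrightarrow> g x y \<in> X"
  obtains A where "A \<subseteq> X" "(card_of A, card_of D) \<in> ordLeq"
    "\<And>g x y. g \<in> G \<Longrightarrow> x \<in> A \<Longrightarrow> y \<in> A \<Longrightarrow> g x y \<in> A"
    "uniformly_open_on (closure A) Y f" "f ` closure A = Y"
proof -
  \<comment> \<open>Besides the radius from uniform openness, \<open>(1/2) ^ n\<close> is imposed as
    a cap, so that the radii tend to 0 and the images of successive lifts converge.\<close>
  have "\<exists>\<delta>>0. \<delta> \<le> (1/2) ^ n \<and>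
          (\<forall>x\<in>X. ball (f x) \<delta> \<inter> Y \<subseteq> f ` (ball x ((1/2) ^ n) \<inter> X))" for n
  proof -
    obtain d where d: "d > 0" "\<And>x. x \<in> X \<Longrightarrow> ball (f x) d \<inter> Y \<subseteq> f ` (ball x ((1/2) ^ n) \<inter> X)"
      using X(4)[unfolded uniformly_open_on_def, rule_format, of "(1/2) ^ n"] by auto
    have "ball (f x) (min d ((1/2) ^ n)) \<inter> Y \<subseteq> f ` (ball x ((1/2) ^ n) \<inter> X)" if "x \<in> X" for x
      using d(2)[OF that] by (rule order_trans[rotated]) (simp add: Int_mono subset_ball le_infI1)
    thus ?thesis
      using d(1) by (intro exI[of _ "min d ((1/2) ^ n)"]) auto
  qed
  then obtain \<delta> :: "nat \<Rightarrow> real" where \<delta>: "\<And>n. \<delta> n > 0" "\<And>n. \<delta> n \<le> (1/2) ^ n"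
      "\<And>n x. x \<in> X \<Longrightarrow> ball (f x) (\<delta> n) \<inter> Y \<subseteq> f ` (ball x ((1/2) ^ n) \<inter> X)"
    by metis
  have \<delta>0: "\<delta> \<longlonglongrightarrow> 0"
  proof (rule Lim_null_comparison)
    show "(\<lambda>n. (1/2 :: real) ^ n) \<longlonglongrightarrow> 0"
      by (intro LIMSEQ_power_zero) auto
    show "\<forall>\<^sub>F n in sequentially. norm (\<delta> n) \<le> (1/2) ^ n"
      using \<delta>(1,2) by (intro always_eventually) (simp add: abs_of_pos)
  qed
  obtain g where g: "\<And>d. d \<in> D \<Longrightarrow> g d \<in> X \<and> f (g d) = d"
    using X(3) D(2) by (metis image_iff subset_iff)
  \<comment> \<open>The lift is made a total function on \<open>X\<close>: where no lift is
    demanded, any point of \<open>X\<close> will do. Thus \<open>h\<close> maps into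
    \<open>X\<close> and can be used as an operation.\<close>
  have "\<forall>a n d. \<exists>x. a \<in> X \<longrightarrow> x \<in> X \<and>
          (d \<in> D \<longrightarrow> dist (f a) d < \<delta> n \<longrightarrow> dist a x < (1/2) ^ n \<and> f x = d)"
  proof (intro allI)
    fix a n d
    show "\<exists>x. a \<in> X \<longrightarrow> x \<in> X \<and>
            (d \<in> D \<longrightarrow> dist (f a) d < \<delta> n \<longrightarrow> dist a x < (1/2) ^ n \<and> f x = d)"
    proof (cases "a \<in> X \<and> d \<in> D \<and> dist (f a) d < \<delta> n")
      case True
      hence "d \<in> f ` (ball a ((1/2) ^ n) \<inter> X)"
        using \<delta>(3)[of a n] D(2) by auto
      thus ?thesis by auto
    qed blast
  qed
  then obtain h where h: "\<And>a n d. a \<in> X \<Longrightarrow> h a n d \<in> X"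
      "\<And>a n d. a \<in> X \<Longrightarrow> d \<in> D \<Longrightarrow> dist (f a) d < \<delta> n \<Longrightarrow> dist a (h a n d) < (1/2) ^ n \<and> f (h a n d) = d"
    by metis
  \<comment> \<open>Each pair of a level \<open>n\<close> and a point \<open>d\<close> of
    \<open>D\<close> contributes one unary operation, written with an ignored second argument. As
    \<open>D\<close> is infinite, countably many copies of it together with \<open>G\<close> do not
    exceed its cardinality.\<close>
  define F where "F = G \<union> (\<Union>n. (\<lambda>d a _. h a n d) ` D)"
  have "(card_of F, card_of D) \<in> ordLeq"
    unfolding F_def using D(1) G(1)
    by (intro card_of_Un_ordLeq_infinite_Field card_of_UNION_ordLeq_infinite countable_ordLeq_infinite)
      (auto simp: Field_card_of card_of_card_order_on card_of_image)
  moreover have "g x y \<in> X" if "g \<in> F" "x \<in> X" "y \<in> X" for g x y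
    using that G(2) h(1) by (auto simp: F_def)
  moreover have "g ` D \<subseteq> X"
    using g by blast
  ultimately obtain A where A: "g ` D \<subseteq> A" "A \<subseteq> X" "(card_of A, card_of D) \<in> ordLeq"
      "\<And>g x y. g \<in> F \<Longrightarrow> x \<in> A \<Longrightarrow> y \<in> A \<Longrightarrow> g x y \<in> A"
    using closure_under_operations[OF D(1) _ card_of_image, of g X F] by blast
  have ZX: "closure A \<subseteq> X"
    using A(2) X(1) by (simp add: closure_minimal complete_imp_closed)
  have "h a n d \<in> A" if "a \<in> A" "d \<in> D" for a n d
    using A(4)[of "\<lambda>a _. h a n d" a a] that by (auto simp: F_def)
  hence hA: "\<exists>a'\<in>A. dist a a' < (1/2) ^ n \<and> f a' = d" if "a \<in> A" "d \<in> D" "dist (f a) d < \<delta> n" for a n d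
    using that h(2) A(2) by blast
  note limit = approximate_lifts_limit[OF X(1,2) A(2) \<delta>(1) \<delta>0 hA]
  \<comment> \<open>The approximation starts at the chosen preimage of a point of \<open>D\<close>
    within \<open>\<delta> 0\<close> of \<open>y\<close>.\<close>
  have "y \<in> f ` closure A" if y: "y \<in> Y" for y
  proof -
    obtain d where "d \<in> D" "dist d y < \<delta> 0"
      using y D(3) \<delta>(1) unfolding closure_approachable subset_iff by blast
    thus ?thesis
      using limit[where a = "g d" and y = y and m = 0] g[of d] A(1) D(3) y by force
  qed
  hence "f ` closure A = Y"
    using ZX X(3) by blast
  moreover have "uniformly_open_on (closure A) Y f"
    unfolding uniformly_open_on_def
  proof (intro allI impI)
    fix \<epsilon> :: real assume "\<epsilon> > 0"
    \<comment> \<open>The total displacement is below three times \<open>(1/2) ^ m\<close>: one for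
      passing from \<open>z\<close> to a nearby point of \<open>A\<close>, two for the limit of
      lifts starting there.\<close>
    then obtain m where m: "(1/2 :: real) ^ m < \<epsilon> / 3"
      using real_arch_pow_inv[of "\<epsilon> / 3" "1/2"] by auto
    have "y \<in> f ` (ball z \<epsilon> \<inter> closure A)"
      if z: "z \<in> closure A" and y: "y \<in> Y" "dist (f z) y < \<delta> m / 2" for z y
    proof -
      \<comment> \<open>Half of \<open>\<delta> m\<close> is spent on replacing \<open>f z\<close>
        by \<open>f a\<close>, the other half on the distance from \<open>f z\<close> to
        \<open>y\<close>. The radius \<open>e\<close> may depend on \<open>z\<close>, since only
        \<open>\<delta> m / 2\<close> has to be uniform.\<close>
      obtain e where e: "e > 0" "\<And>x. x \<in> X \<Longrightarrow> dist x z < e \<Longrightarrow> dist (f x) (f z) < \<delta> m / 2"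
        using X(2)[unfolded continuous_on_iff, rule_format, of z "\<delta> m / 2"] z ZX \<delta>(1)[of m] by auto
      obtain a where a: "a \<in> A" "dist a z < min e ((1/2) ^ m)"
        using z[unfolded closure_approachable, rule_format, of "min e ((1/2) ^ m)"] e(1) by auto
      have "dist (f a) y < \<delta> m"
        using e(2)[of a] a A(2) y(2) dist_triangle[of "f a" y "f z"] by auto
      then obtain x where x: "x \<in> closure A" "dist a x \<le> 2 * (1/2) ^ m" "f x = y"
        using limit a(1) y(1) D(3) by blast
      have "dist z x < \<epsilon>"
        using x(2) a(2) m dist_triangle[of z x a] by (simp add: dist_commute)
      thus ?thesis
        using x by auto
    qed
    thus "\<exists>\<delta>>0. \<forall>x\<in>closure A. ball (f x) \<delta> \<inter> Y \<subseteq> f ` (ball x \<epsilon> \<inter> closure A)"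
      using \<delta>(1)[of m] by (intro exI[of _ "\<delta> m / 2"]) auto
  qed
  ultimately show ?thesis
    using A that[of A] by (auto simp: F_def)
qed

section \<open>Finite density and the metric case\<close>

lemma dens_witness:
  obtains D where "D \<subseteq> Y" "Y \<subseteq> closure D" "dens (top_of_set Y) = card_of D"
  using dens_attained[of "top_of_set Y"] by (auto simp: dense_in_top_of_set_iff)

lemma finite_dense_eq:
  fixes D :: "'a::t1_space set"
  assumes "finite D" "D \<subseteq> Y" "Y \<subseteq> closure D"
  shows "Y = D"
  using assms finite_imp_closed closure_closed by blast

text \<open>Distinct points of a finite \<open>Y\<close> have a common positive separation
  \<open>d\<close>. A ball of radius \<open>d\<close> about \<open>f x\<close> then meets
  \<open>Y\<close> only in \<open>f x\<close>, which is attained at the centre \<open>x\<close> of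
  every ball about it.\<close>

lemma uniformly_open_on_finite:
  fixes f :: "'a::metric_space \<Rightarrow> 'b::metric_space"
  assumes "finite Y" "f ` Z \<subseteq> Y"
  shows "uniformly_open_on Z Y f"
proof -
  obtain d where d: "d > 0" "\<And>x y. x \<in> Y \<Longrightarrow> y \<in> Y \<Longrightarrow> x \<noteq> y \<Longrightarrow> d \<le> dist x y"
  proof -
    have "\<exists>d>0. \<forall>y\<in>Y. x \<noteq> y \<longrightarrow> d \<le> dist x y" for x
      using finite_set_avoid[OF assms(1), of x] by metis
    then obtain r where r: "\<And>x. r x > 0" "\<And>x y. y \<in> Y \<Longrightarrow> x \<noteq> y \<Longrightarrow> r x \<le> dist x y"
      by metis
    \<comment> \<open>Inserting 1 keeps the minimum defined when \<open>Y\<close> is empty.\<close>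
    show ?thesis
    proof (rule that[of "Min (insert 1 (r ` Y))"])
      show "Min (insert 1 (r ` Y)) \<le> dist x y" if "x \<in> Y" "y \<in> Y" "x \<noteq> y" for x y
        using r(2)[OF that(2,3)] that(1) assms(1) by (intro order.trans[OF Min_le]) auto
    qed (use r(1) assms(1) in auto)
  qed
  have "ball (f x) d \<inter> Y \<subseteq> f ` (ball x e \<inter> Z)" if "x \<in> Z" "e > 0" for x e
  proof
    fix y assume "y \<in> ball (f x) d \<inter> Y"
    hence "y = f x"
      using d(2)[of "f x" y] that(1) assms(2) by force
    thus "y \<in> f ` (ball x e \<inter> Z)"
      using that by auto
  qed
  thus ?thesis
    unfolding uniformly_open_on_def using d(1) by blast
qed

theorem uniformly_open_metric_restriction:
  fixes X :: "'a::metric_space set" and Y :: "'b::metric_space set"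
  assumes X: "complete X" "continuous_on X f" "f ` X = Y" "uniformly_open_on X Y f"
  shows "\<exists>Z\<subseteq>X. closedin (top_of_set X) Z \<and>
           (dens (top_of_set Z), dens (top_of_set Y)) \<in> ordIso \<and>
           uniformly_open_on Z Y f \<and> f ` Z = Y"
proof -
  obtain D where D: "D \<subseteq> Y" "Y \<subseteq> closure D" "dens (top_of_set Y) = card_of D"
    by (rule dens_witness)
  have "\<exists>A. closure A \<subseteq> X \<and> (card_of A, card_of D) \<in> ordLeq \<and>
          uniformly_open_on (closure A) Y f \<and> f ` closure A = Y"
  proof (cases "finite D")
    case True
    have Y: "Y = D"
      using True D finite_dense_eq by blast
    obtain g where g: "\<And>y. y \<in> Y \<Longrightarrow> g y \<in> X \<and> f (g y) = y"
      using X(3) by (metis image_iff)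
    \<comment> \<open>For finite \<open>Y\<close>, the image of a section of \<open>f\<close> is
      finite, hence closed, and can serve as both \<open>A\<close> and its closure.\<close>
    have cl: "closure (g ` Y) = g ` Y"
      using True Y by (intro closure_closed finite_imp_closed) auto
    have "f ` g ` Y = Y"
      using g by force
    moreover from this have "uniformly_open_on (g ` Y) Y f"
      using True Y by (intro uniformly_open_on_finite) auto
    ultimately show ?thesis
      using g cl Y card_of_image by (intro exI[of _ "g ` Y"]) auto
  next
    case False
    obtain A where A: "A \<subseteq> X" "(card_of A, card_of D) \<in> ordLeq"
        "uniformly_open_on (closure A) Y f" "f ` closure A = Y"
      using uniformly_open_restriction[OF X False D(1,2), of "{}"] by auto
    thus ?thesis
      using X(1) by (metis closure_minimal complete_imp_closed)
  qed
  then obtain A where A: "closure A \<subseteq> X" "(card_of A, card_of D) \<in> ordLeq"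
      "uniformly_open_on (closure A) Y f" "f ` closure A = Y"
    by blast
  have "(dens (top_of_set (closure A)), dens (top_of_set Y)) \<in> ordIso"
    using A D(3) closure_subset continuous_on_subset[OF X(2)]
    by (intro dens_eq_of_dense_and_surj[of A]) auto
  thus ?thesis
    using A by (intro exI[of _ "closure A"]) (auto intro: closed_subset)
qed

section \<open>Closed linear subspaces\<close>

text \<open>Stability passes to the closure by continuity in two stages: first in the vector, for a
  fixed scalar in \<open>Q\<close>, and then in the scalar, for a fixed vector of the closure.
  Homogeneity of the norm supplies both continuities.\<close>

lemma subspace_closure_dense_scalars:
  fixes scale :: "'s::real_normed_field \<Rightarrow> 'v::real_normed_vector \<Rightarrow> 'v"
  assumes vs: "vector_space scale"
    and norm: "\<And>c x. norm (scale c x) = norm c * norm x"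
    and Q: "closure Q = UNIV"
    and A: "A \<noteq> {}" "\<And>x y. x \<in> A \<Longrightarrow> y \<in> A \<Longrightarrow> x + y \<in> A"
      "\<And>q x. q \<in> Q \<Longrightarrow> x \<in> A \<Longrightarrow> scale q x \<in> A"
  shows "module.subspace scale (closure A)"
proof -
  interpret vector_space scale by fact
  have lip1: "dist (scale q x) (scale q y) = norm q * dist x y" for q x y
    by (simp add: dist_norm norm flip: scale_right_diff_distrib)
  have lip2: "dist (scale p x) (scale q x) = norm x * dist p q" for p q x
    by (simp add: dist_norm norm mult.commute flip: scale_left_diff_distrib)
  have cont1: "continuous_on S (scale q)" for S q
    by (rule lipschitz_on_continuous_on[of "norm q"]) (simp add: lipschitz_on_def lip1)
  have cont2: "continuous_on S (\<lambda>q. scale q x)" for S x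
    by (rule lipschitz_on_continuous_on[of "norm x"]) (simp add: lipschitz_on_def lip2)
  have "scale q x \<in> closure A" if "q \<in> Q" "x \<in> closure A" for q x
    using image_closure_subset[of A "scale q" "closure A"] cont1 that A(3) closure_subset by blast
  hence scale: "scale c x \<in> closure A" if "x \<in> closure A" for c x
    using image_closure_subset[of Q "\<lambda>c. scale c x" "closure A"] cont2 that Q by blast
  have add: "x + y \<in> closure A" if "x \<in> closure A" "y \<in> closure A" for x y
  proof -
    \<comment> \<open>Addition is continuous on the product, and the closure of
      \<open>A \<times> A\<close> is the product of the closures.\<close>
    have "(\<lambda>p. fst p + snd p) ` closure (A \<times> A) \<subseteq> closure A"
      using A(2) closure_subset by (intro image_closure_subset continuous_intros) fastforce+
    thus ?thesis
      using that by (force simp: closure_Times)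
  qed
  have "0 \<in> closure A"
    using A(1) scale[of _ 0] closure_subset by fastforce
  thus ?thesis
    using add scale unfolding subspace_def by blast
qed

text \<open>An abstract scalar field treats real and complex Banach spaces at once; second
  countability provides the countable dense set of scalars.\<close>

theorem uniformly_open_linear_restriction:
  fixes scale :: "'s::{real_normed_field, second_countable_topology} \<Rightarrow> 'v::banach \<Rightarrow> 'v"
    and f :: "'v \<Rightarrow> 'b::metric_space"
  assumes vs: "vector_space scale"
    and norm: "\<And>c x. norm (scale c x) = norm c * norm x"
    and f: "continuous_on UNIV f" "f ` UNIV = Y" "uniformly_open_on UNIV Y f"
  shows "\<exists>Z. module.subspace scale Z \<and> closed Z \<and>
           (dens (top_of_set Z), dens (top_of_set Y)) \<in> ordIso \<and>
           uniformly_open_on Z Y f \<and> f ` Z = Y"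
proof -
  interpret vector_space scale by fact
  obtain D where D: "D \<subseteq> Y" "Y \<subseteq> closure D" "dens (top_of_set Y) = card_of D"
    by (rule dens_witness)
  have "\<exists>A. subspace (closure A) \<and> (card_of A, card_of D) \<in> ordLeq \<and>
          uniformly_open_on (closure A) Y f \<and> f ` closure A = Y"
  proof (cases "finite D")
    case True
    have Y: "Y = D"
      using True D finite_dense_eq by blast
    \<comment> \<open>As a continuous image of a connected space, a finite \<open>Y\<close> is a
      single point, so the zero subspace already maps onto it.\<close>
    moreover have "connected Y"
      using f connected_continuous_image connected_UNIV by blast
    ultimately obtain y where y: "Y = {y}"
      using True f(2) connected_finite_iff_sing by (metis UNIV_not_empty image_is_empty)
    moreover have "f 0 = y"
      using f(2) y by blast
    moreover have "uniformly_open_on {0} Y f"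
      using f(2) y by (intro uniformly_open_on_finite) auto
    moreover have "(card_of {0 :: 'v}, card_of {y}) \<in> ordLeq"
      using card_of_image[of "\<lambda>_. 0" "{y}"] by simp
    ultimately show ?thesis
      using Y by (intro exI[of _ "{0}"]) auto
  next
    case False
    obtain Q :: "'s set" where Q: "countable Q" "\<And>U. open U \<Longrightarrow> U \<noteq> {} \<Longrightarrow> \<exists>q\<in>Q. q \<in> U"
      using countable_dense_setE by blast
    have clQ: "closure Q = UNIV"
    proof -
      have "\<exists>q\<in>Q. dist q c < e" if "e > 0" for c e
        using Q(2)[of "ball c e"] that by (auto simp: dist_commute)
      thus ?thesis
        by (auto simp: closure_approachable)
    qed
    \<comment> \<open>Closing \<open>A\<close> under all scalars could exceed the cardinality of
      \<open>D\<close>; the countable dense set \<open>Q\<close> keeps \<open>G\<close> countable,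
      and the remaining scalars are recovered in the closure.\<close>
    define G where "G = insert (+) ((\<lambda>q x _. scale q x) ` Q)"
    have "countable G"
      using Q(1) by (simp add: G_def)
    then obtain A where A: "(card_of A, card_of D) \<in> ordLeq"
        "\<And>g x y. g \<in> G \<Longrightarrow> x \<in> A \<Longrightarrow> y \<in> A \<Longrightarrow> g x y \<in> A"
        "uniformly_open_on (closure A) Y f" "f ` closure A = Y"
      using uniformly_open_restriction[OF complete_UNIV f False D(1,2), of G] by auto
    have "A \<noteq> {}"
      using A(4) f(2) by auto
    moreover have "x + y \<in> A" if "x \<in> A" "y \<in> A" for x y
      using A(2)[OF _ that, of "(+)"] by (simp add: G_def)
    moreover have "scale q x \<in> A" if "q \<in> Q" "x \<in> A" for q x
      using A(2)[OF _ that(2,2), of "\<lambda>x _. scale q x"] that(1) by (auto simp: G_def)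
    ultimately have "subspace (closure A)"
      by (rule subspace_closure_dense_scalars[OF vs norm clQ])
    thus ?thesis
      using A by blast
  qed
  then obtain A where A: "subspace (closure A)" "(card_of A, card_of D) \<in> ordLeq"
      "uniformly_open_on (closure A) Y f" "f ` closure A = Y"
    by blast
  have "(dens (top_of_set (closure A)), dens (top_of_set Y)) \<in> ordIso"
    using A D(3) closure_subset continuous_on_subset[OF f(1)]
    by (intro dens_eq_of_dense_and_surj[of A]) auto
  thus ?thesis
    using A by (intro exI[of _ "closure A"]) auto
qed

section \<open>The metric, real Banach and complex Banach cases together\<close>

theorem theoremA:
  shows "(\<forall>(X :: 'a::metric_space set) (Y :: 'b::metric_space set) f.
            complete X \<and> continuous_on X f \<and> f ` X = Y \<and> uniformly_open_on X Y f \<longrightarrow>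
            (\<exists>Z\<subseteq>X. closedin (top_of_set X) Z \<and>
               (dens (top_of_set Z), dens (top_of_set Y)) \<in> ordIso \<and>
               uniformly_open_on Z Y f \<and> f ` Z = Y))
       \<and> (\<forall>(Y :: 'b set) (f :: 'c::banach \<Rightarrow> 'b).
            continuous_on UNIV f \<and> f ` UNIV = Y \<and> uniformly_open_on UNIV Y f \<longrightarrow>
            (\<exists>Z. subspace Z \<and> closed Z \<and>
               (dens (top_of_set Z), dens (top_of_set Y)) \<in> ordIso \<and>
               uniformly_open_on Z Y f \<and> f ` Z = Y))
       \<and> (\<forall>(scaleC :: complex \<Rightarrow> 'd::banach \<Rightarrow> 'd) (Y :: 'b set) f.
            complex_banach scaleC \<and>
            continuous_on UNIV f \<and> f ` UNIV = Y \<and> uniformly_open_on UNIV Y f \<longrightarrow>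
            (\<exists>Z. module.subspace scaleC Z \<and> closed Z \<and>
               (dens (top_of_set Z), dens (top_of_set Y)) \<in> ordIso \<and>
               uniformly_open_on Z Y f \<and> f ` Z = Y))"
proof (intro conjI allI impI; elim conjE)
  fix X :: "'a set" and Y :: "'b set" and f
  assume "complete X" "continuous_on X f" "f ` X = Y" "uniformly_open_on X Y f"
  thus "\<exists>Z\<subseteq>X. closedin (top_of_set X) Z \<and>
          (dens (top_of_set Z), dens (top_of_set Y)) \<in> ordIso \<and>
          uniformly_open_on Z Y f \<and> f ` Z = Y"
    by (rule uniformly_open_metric_restriction)
next
  fix Y :: "'b set" and f :: "'c \<Rightarrow> 'b"
  assume f: "continuous_on UNIV f" "f ` UNIV = Y" "uniformly_open_on UNIV Y f"
  show "\<exists>Z. subspace Z \<and> closed Z \<and>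
          (dens (top_of_set Z), dens (top_of_set Y)) \<in> ordIso \<and>
          uniformly_open_on Z Y f \<and> f ` Z = Y"
    \<comment> \<open>This turns the real notion of subspace into \<open>module.subspace\<close> for
      \<open>scaleR\<close>, the form in which the result for a general scalar field
      applies.\<close>
    unfolding subspace_raw_def
    using f by (intro uniformly_open_linear_restriction) (auto intro: real_vector.vector_space_axioms)
next
  fix scaleC :: "complex \<Rightarrow> 'd \<Rightarrow> 'd" and Y :: "'b set" and f :: "'d \<Rightarrow> 'b"
  assume "complex_banach scaleC"
    and f: "continuous_on UNIV f" "f ` UNIV = Y" "uniformly_open_on UNIV Y f"
  then interpret complex_banach scaleC by simp
  show "\<exists>Z. module.subspace scaleC Z \<and> closed Z \<and>
          (dens (top_of_set Z), dens (top_of_set Y)) \<in> ordIso \<and>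
          uniformly_open_on Z Y f \<and> f ` Z = Y"
    using f norm_scaleC by (intro uniformly_open_linear_restriction) (auto intro: vector_space_axioms)
qed

end
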